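(* Let $w\in S_\infty$ and $i\ge1$ with $l(ws_i)=l(w)-1$. Then: (1) the sets $\mathrm{mitosis}'_i(D)$, $D\in\mathcal P_s(w)$, are pairwise disjoint and $\bigsqcup_{D\in\mathcal P_s(w)}\mathrm{mitosis}'_i(D)=\mathcal P(ws_i)$; (2) the sets $\mathrm{mitosis}'_i(D)$, $D\in\mathcal P_I(w)$, are pairwise disjoint and $\bigsqcup_{D\in\mathcal P_I(w)}\mathrm{mitosis}'_i(D)=\mathcal P_\varnothing(w)$.
   Context: Permutations: $S_\infty=\bigcup_n S_n$ is generated by the simple transpositions $s_a=(a\ a{+}1)$, $a\ge 1$; $l(w)$ is the Coxeter length of $w$. A pipe dream is a finite subset $D\subset\mathbb{Z}_{>0}\times\mathbb{Z}_{>0}$; its elements $(r,c)$ are called crosses (in row $r$, column $c$). The reading word of $D$ is obtained by listing the crosses row by row from top to bottom, within each row from right to left (decreasing $c$), and recording for each cross $(r,c)$ its antidiagonal index $r+c-1$; this gives a word $(a_1,\dots,a_k)$. For $u\in S_\infty$ put $u\star s_a=us_a$ if $l(us_a)=l(u)+1$ and $u\star s_a=u$ otherwise. The Demazure product of $D$ is $\delta(D)=(\cdots((e\star s_{a_1})\star s_{a_2})\cdots)\star s_{a_k}$. For $w\in S_\infty$, $\mathcal P(w)=\{D:\delta(D)=w\}$. Mitosis: $\mathrm{start}_i(D)=\min\{c\ge 1:(i,c)\notin D\}$, $\mathcal J_i(D)=\{c<\mathrm{start}_i(D): (i+1,c)\notin D\}$. For $p\in\mathcal J_i(D)$, $D_p=\big(D\setminus(\{(i,p)\}\cup\{(i,c):c\in\mathcal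 J_i(D),c<p\})\big)\cup\{(i+1,c):c\in\mathcal J_i(D),c<p\}$ (delete $(i,p)$ and move each $(i,c)$, $c\in\mathcal J_i(D)$, $c<p$, down to $(i+1,c)$). $\mathrm{mitosis}_i(D)=\{D_p:p\in\mathcal J_i(D)\}$. If $\mathcal J_i(D)=\{j_1<\dots<j_k\}$, then $\mathrm{mitosis}'_i(D)=\{D_{j_1},\,D_{j_1}\cup D_{j_2},\,D_{j_2},\,\dots,\,D_{j_{k-1}}\cup D_{j_k},\,D_{j_k}\}$; it is empty if $\mathcal J_i(D)=\emptyset$. Partition of $\mathcal P(w)$ (for fixed $i$ with $l(ws_i)=l(w)-1$): $\mathcal P_\varnothing(w)=\{D\in\mathcal P(w):\mathcal J_i(D)=\emptyset\}$; $\mathcal P_s(w)=\{D\in\mathcal P(w):\mathcal J_i(D)\ne\emptyset,\ \mathrm{mitosis}_i(D)\subseteq\mathcal P(ws_i)\}$; $\mathcal P_I(w)=\{D\in\mathcal P(w):\mathcal J_i(D)\neq\emptyset,\ \mathrm{mitosis}_i(D)\subseteq\mathcal P(w)\}$. (Every $D\in\mathcal P(w)$ with $\mathcal J_i(D)\ne\emptyset$ lies in exactly one of $\mathcal P_s(w)$, $\mathcal P_I(w)$.) *)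

theory Defs
  imports Main "HOL-Library.Disjoint_Sets"
begin

text \<open>Permutations of the positive integers with finite support, represented as
functions nat => nat fixing 0. Multiplication u w is composition u o w.\<close>

definition S_inf :: "(nat \<Rightarrow> nat) set" where
  "S_inf = {w. bij w \<and> finite {x. w x \<noteq> x} \<and> w 0 = 0}"

definition s :: "nat \<Rightarrow> nat \<Rightarrow> nat" where
  "s a = (\<lambda>x. if x = a then a + 1 else if x = a + 1 then a else x)"

definition word_prod :: "nat list \<Rightarrow> nat \<Rightarrow> nat" where
  "word_prod ws = foldr (\<lambda>a f. s a \<circ> f) ws id"

definition len :: "(nat \<Rightarrow> nat) \<Rightarrow> nat" where
  "len w = (LEAST k. \<exists>ws. length ws = k \<and> (\<forall>a\<in>set ws. 1 \<le> a) \<and> word_prod ws = w)"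

definition dstar :: "(nat \<Rightarrow> nat) \<Rightarrow> nat \<Rightarrow> (nat \<Rightarrow> nat)" where
  "dstar u a = (if len (u \<circ> s a) = len u + 1 then u \<circ> s a else u)"

definition pipe_dream :: "(nat \<times> nat) set \<Rightarrow> bool" where
  "pipe_dream D \<longleftrightarrow> finite D \<and> (\<forall>(r, c)\<in>D. 1 \<le> r \<and> 1 \<le> c)"

definition reading_word :: "(nat \<times> nat) set \<Rightarrow> nat list" where
  "reading_word D =
     concat (map (\<lambda>r. map (\<lambda>c. r + c - 1) (rev (sorted_list_of_set {c. (r, c) \<in> D})))
                 [1..<Suc (Max (fst ` D))])"

definition demazure :: "(nat \<times> nat) set \<Rightarrow> nat \<Rightarrow> nat" where
  "demazure D = foldl dstar id (reading_word D)"

definition PD :: "(nat \<Rightarrow> nat) \<Rightarrow> (nat \<times> nat) set set" where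
  "PD w = {D. pipe_dream D \<and> demazure D = w}"

definition start :: "nat \<Rightarrow> (nat \<times> nat) set \<Rightarrow> nat" where
  "start i D = (LEAST c. 1 \<le> c \<and> (i, c) \<notin> D)"

definition J :: "nat \<Rightarrow> (nat \<times> nat) set \<Rightarrow> nat set" where
  "J i D = {c. 1 \<le> c \<and> c < start i D \<and> (i + 1, c) \<notin> D}"

definition Dp :: "nat \<Rightarrow> (nat \<times> nat) set \<Rightarrow> nat \<Rightarrow> (nat \<times> nat) set" where
  "Dp i D p = (D - ({(i, p)} \<union> {(i, c) | c. c \<in> J i D \<and> c < p}))
               \<union> {(i + 1, c) | c. c \<in> J i D \<and> c < p}"

definition mitosis :: "nat \<Rightarrow> (nat \<times> nat) set \<Rightarrow> (nat \<times> nat) set set" where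
  "mitosis i D = Dp i D ` J i D"

definition mitosis' :: "nat \<Rightarrow> (nat \<times> nat) set \<Rightarrow> (nat \<times> nat) set set" where
  "mitosis' i D = Dp i D ` J i D \<union>
     {Dp i D p \<union> Dp i D q | p q. p \<in> J i D \<and> q \<in> J i D \<and> p < q \<and>
                                  \<not> (\<exists>r\<in>J i D. p < r \<and> r < q)}"

definition P_empty :: "(nat \<Rightarrow> nat) \<Rightarrow> nat \<Rightarrow> (nat \<times> nat) set set" where
  "P_empty w i = {D \<in> PD w. J i D = {}}"

definition P_s :: "(nat \<Rightarrow> nat) \<Rightarrow> nat \<Rightarrow> (nat \<times> nat) set set" where
  "P_s w i = {D \<in> PD w. J i D \<noteq> {} \<and> mitosis i D \<subseteq> PD (w \<circ> s i)}"

definition P_I :: "(nat \<Rightarrow> nat) \<Rightarrow> nat \<Rightarrow> (nat \<times> nat) set set" where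
  "P_I w i = {D \<in> PD w. J i D \<noteq> {} \<and> mitosis i D \<subseteq> PD w}"

end

theory Submission
  imports Defs
begin

text \<open>Write t_c for the generator of the 0-Hecke monoid with index i + c - 1. Up to commutations,
rows i and i + 1 of a pipe dream may be read column by column, from right to left; a column c
containing both crosses contributes f_c = t_c t_{c+1}, and the braid relation says
t_{c+1} f_c = f_c t_c. Pushing a generator through a run of full columns shows that the elements
of mitosis' i D all have the same Demazure product, and that multiplying it by s_i
(which commutes with all rows below row i + 1) gives the Demazure product of D. Combinatorially,
every pipe dream E with J i E empty lies in mitosis' i D for exactly one D, and D can be read off
from the first gap of E in row i + 1 and the next gap in row i. Since every pipe dream for
w s_i has empty J, both statements follow.\<close>

section \<open>Coxeter length and inversions\<close>

text \<open>Inversions are pairs of positions, not of values, so that right multiplication by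
  \<open>s a\<close> relabels them.\<close>

definition inversions :: "(nat \<Rightarrow> nat) \<Rightarrow> (nat \<times> nat) set" where
  "inversions w = {(x, y). x < y \<and> w y < w x}"

lemma s_s [simp]: "s a (s a x) = x"
  by (simp add: s_def)

lemma s_comp_s [simp]: "s a \<circ> s a = id"
  by (simp add: fun_eq_iff)

lemma s_in_S_inf:
  assumes "1 \<le> a"
  shows "s a \<in> S_inf"
proof -
  have "bij (s a)" by (rule o_bij[of "s a"]) auto
  moreover have "finite {x. s a x \<noteq> x}"
    by (rule finite_subset[of _ "{a, a + 1}"]) (auto simp: s_def split: if_splits)
  ultimately show ?thesis
    using assms by (auto simp: S_inf_def s_def)
qed

lemma S_inf_comp:
  assumes "u \<in> S_inf" "v \<in> S_inf"
  shows "u \<circ> v \<in> S_inf"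
proof -
  have "{x. (u \<circ> v) x \<noteq> x} \<subseteq> {x. u x \<noteq> x} \<union> {x. v x \<noteq> x}" by auto
  then have "finite {x. (u \<circ> v) x \<noteq> x}"
    using assms by (auto simp: S_inf_def intro: finite_subset)
  then show ?thesis
    using assms by (auto simp: S_inf_def intro: bij_comp)
qed

lemma id_in_S_inf: "id \<in> S_inf"
  using bij_id by (simp add: S_inf_def)

lemma inversions_id: "inversions id = {}"
  by (auto simp: inversions_def)

lemma word_prod_Nil: "word_prod [] = id"
  by (simp add: word_prod_def)

lemma finite_inversions:
  assumes "w \<in> S_inf"
  shows "finite (inversions w)"
proof -
  have fin: "finite {x. w x \<noteq> x}" and inj: "inj w"
    using assms by (auto simp: S_inf_def bij_def)
  obtain N where N: "\<And>x. w x \<noteq> x \<Longrightarrow> x < N"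
    using fin by (auto simp: finite_nat_set_iff_bounded)
  \<comment> \<open>If \<open>w x\<close> were at least \<open>N\<close>, then \<open>w\<close>
    would fix \<open>w x\<close>, and injectivity would give \<open>w x = x\<close>, against
    \<open>x < N\<close>.\<close>
  have small: "w x < N" if "x < N" for x
    by (metis N inj injD that)
  have "inversions w \<subseteq> {..<N} \<times> {..<N}"
  proof clarify
    fix x y assume "(x, y) \<in> inversions w"
    then have xy: "x < y" "w y < w x" by (auto simp: inversions_def)
    have "y < N"
    proof (rule ccontr)
      assume "\<not> y < N"
      then have "w y = y" using N by blast
      moreover have "w x < N \<or> w x = x" using N small by blast
      ultimately show False using xy \<open>\<not> y < N\<close> by linarith
    qed
    then show "x \<in> {..<N} \<and> y \<in> {..<N}" using xy by simp
  qed
  then show ?thesis by (rule finite_subset) simp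
qed

text \<open>Swapping \<open>a\<close> and \<open>a + 1\<close> preserves the order of every other
  pair of positions, so the old inversions are only relabelled. The ascent at \<open>a\<close>
  becomes the single new inversion.\<close>

lemma inversions_comp_s:
  assumes "w a < w (a + 1)"
  shows "inversions (w \<circ> s a) = insert (a, a + 1) (map_prod (s a) (s a) ` inversions w)"
    and "(a, a + 1) \<notin> map_prod (s a) (s a) ` inversions w"
proof -
  have mem: "(x, y) \<in> map_prod (s a) (s a) ` inversions w \<longleftrightarrow> (s a x, s a y) \<in> inversions w"
    for x y
    by (force simp: image_iff)
  show "inversions (w \<circ> s a) = insert (a, a + 1) (map_prod (s a) (s a) ` inversions w)"
  proof (rule set_eqI, clarify)
    fix x y
    have "s a x < s a y \<longleftrightarrow> x < y" if "(x, y) \<noteq> (a, a + 1)" "(x, y) \<noteq> (a + 1, a)"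
      using that by (auto simp: s_def)
    then show "(x, y) \<in> inversions (w \<circ> s a) \<longleftrightarrow>
        (x, y) \<in> insert (a, a + 1) (map_prod (s a) (s a) ` inversions w)"
      unfolding insert_iff mem using assms
      by (cases "(x, y) = (a, a + 1)"; cases "(x, y) = (a + 1, a)") (auto simp: inversions_def s_def)
  qed
  show "(a, a + 1) \<notin> map_prod (s a) (s a) ` inversions w"
    unfolding mem by (simp add: inversions_def s_def)
qed

lemma card_inversions_comp_s:
  assumes "w \<in> S_inf" "w a < w (a + 1)"
  shows "card (inversions (w \<circ> s a)) = Suc (card (inversions w))"
proof -
  have "inj (map_prod (s a) (s a))"
    by (rule inj_on_inverseI[where g = "map_prod (s a) (s a)"]) auto
  then show ?thesis
    using inversions_comp_s[of w a] assms
    by (simp add: finite_inversions card_image inj_on_subset)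
qed

lemma card_inversions_comp_s_descent:
  assumes "w \<in> S_inf" "1 \<le> a" "w (a + 1) < w a"
  shows "card (inversions w) = Suc (card (inversions (w \<circ> s a)))"
proof -
  have "(w \<circ> s a) \<circ> s a = w" by (simp add: fun_eq_iff)
  moreover have "(w \<circ> s a) a < (w \<circ> s a) (a + 1)" using assms by (simp add: s_def)
  ultimately show ?thesis
    using card_inversions_comp_s[of "w \<circ> s a" a] S_inf_comp[OF assms(1) s_in_S_inf] assms(2)
    by simp
qed

lemma word_prod_snoc: "word_prod (ws @ [a]) = word_prod ws \<circ> s a"
proof -
  have "foldr (\<lambda>a f. s a \<circ> f) ws g = foldr (\<lambda>a f. s a \<circ> f) ws id \<circ> g" for g
    by (induction ws) (auto simp: fun_eq_iff)
  from this[of "s a"] show ?thesis by (simp add: word_prod_def)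
qed

text \<open>A strictly increasing self-map of the naturals satisfies \<open>x \<le> w x\<close>;
  surjectivity excludes strict inequality.\<close>

lemma S_inf_ascending_imp_id:
  assumes "w \<in> S_inf" "\<And>a. 1 \<le> a \<Longrightarrow> w a < w (a + 1)"
  shows "w = id"
proof -
  have b: "bij w" and w0: "w 0 = 0" using assms(1) by (auto simp: S_inf_def)
  \<comment> \<open>The ascent at 0 is not among the hypotheses; it follows from
    \<open>w 0 = 0\<close> and injectivity.\<close>
  have "w 0 < w (Suc 0)"
    using b w0 by (metis bij_is_inj gr0I injD nat.distinct(1))
  then have mono: "strict_mono w"
    unfolding strict_mono_Suc_iff using assms(2) by (metis Suc_eq_plus1 Suc_leI gr0I One_nat_def)
  have "w x = x" for x
  proof (induction x rule: less_induct)
    case (less x)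
    obtain y where y: "w y = x" using b by (metis bij_pointE)
    have "x \<le> w x" using mono by (rule strict_mono_imp_increasing)
    \<comment> \<open>Otherwise the preimage \<open>y\<close> of \<open>x\<close> is smaller than
      \<open>x\<close> by monotonicity, and the induction hypothesis gives
      \<open>y = w y = x\<close>.\<close>
    moreover have "\<not> x < w x"
      by (metis less.IH mono nat_neq_iff strict_mono_less y)
    ultimately show ?case by simp
  qed
  then show ?thesis by auto
qed

text \<open>Sorting by adjacent swaps: undoing a descent removes exactly one inversion, and without
  descents the permutation is the identity.\<close>

lemma ex_word_of_length_inversions:
  assumes "w \<in> S_inf"
  shows "\<exists>ws. length ws = card (inversions w) \<and> (\<forall>a\<in>set ws. 1 \<le> a) \<and> word_prod ws = w"
  using assms
proof (induction "card (inversions w)" arbitrary: w rule: less_induct)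
  case less
  show ?case
  proof (cases "\<exists>a\<ge>1. w (a + 1) < w a")
    case True
    then obtain a where a: "1 \<le> a" "w (a + 1) < w a" by blast
    have c: "card (inversions w) = Suc (card (inversions (w \<circ> s a)))"
      using card_inversions_comp_s_descent[OF less.prems a] .
    obtain ws where "length ws = card (inversions (w \<circ> s a))" "\<forall>a\<in>set ws. 1 \<le> a"
        "word_prod ws = w \<circ> s a"
      using less.hyps[of "w \<circ> s a"] c S_inf_comp[OF less.prems s_in_S_inf[OF a(1)]] by auto
    then show ?thesis
      using c a(1) by (intro exI[of _ "ws @ [a]"]) (auto simp: word_prod_snoc fun_eq_iff)
  next
    case False
    have "inj w" using less.prems by (auto simp: S_inf_def bij_def)
    then have "w a < w (a + 1)" if "1 \<le> a" for a
      using False that by (metis injD linorder_neqE_nat n_not_Suc_n Suc_eq_plus1)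
    then have "w = id" using S_inf_ascending_imp_id less.prems by blast
    then show ?thesis by (intro exI[of _ "[]"]) (simp add: word_prod_Nil inversions_id)
  qed
qed

lemma word_prod_in_S_inf:
  assumes "\<forall>a\<in>set ws. 1 \<le> a"
  shows "word_prod ws \<in> S_inf"
  using assms
proof (induction ws rule: rev_induct)
  case Nil
  show ?case by (simp only: word_prod_Nil id_in_S_inf)
next
  case (snoc a ws)
  then have "word_prod ws \<circ> s a \<in> S_inf" by (intro S_inf_comp s_in_S_inf) simp_all
  then show ?case by (subst word_prod_snoc)
qed

text \<open>Each generator changes the number of inversions by one, up or down; this is the lower
  bound for the length.\<close>

lemma card_inversions_word_prod_le:
  assumes "\<forall>a\<in>set ws. 1 \<le> a"
  shows "card (inversions (word_prod ws)) \<le> length ws"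
  using assms
proof (induction ws rule: rev_induct)
  case Nil
  show ?case by (simp only: word_prod_Nil inversions_id card.empty)
next
  case (snoc a ws)
  let ?u = "word_prod ws"
  have u: "?u \<in> S_inf" "1 \<le> a" using snoc.prems by (auto intro: word_prod_in_S_inf)
  then have "?u a \<noteq> ?u (a + 1)" by (auto simp: S_inf_def bij_def inj_eq)
  then have "card (inversions (?u \<circ> s a)) \<le> Suc (card (inversions ?u))"
    using card_inversions_comp_s[OF u(1), of a] card_inversions_comp_s_descent[OF u]
    by linarith
  then show ?case using snoc by (subst word_prod_snoc) simp
qed

lemma len_eq_card_inversions:
  assumes "w \<in> S_inf"
  shows "len w = card (inversions w)"
  unfolding len_def
proof (rule Least_equality)
  show "\<exists>ws. length ws = card (inversions w) \<and> (\<forall>a\<in>set ws. 1 \<le> a) \<and> word_prod ws = w"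
    by (rule ex_word_of_length_inversions[OF assms])
qed (use card_inversions_word_prod_le in blast)

section \<open>The Hecke action on words\<close>

text \<open>On permutations, the Demazure step puts the values at positions a and a + 1 into
decreasing order. In this form the braid relations hold for arbitrary functions.\<close>

definition sort_at :: "(nat \<Rightarrow> nat) \<Rightarrow> nat \<Rightarrow> nat \<Rightarrow> nat" where
  "sort_at u a = u(a := max (u a) (u (a + 1)), a + 1 := min (u a) (u (a + 1)))"

text \<open>The length grows exactly at an ascent, which is also where sorting swaps the two
  values.\<close>

lemma dstar_eq_sort_at:
  assumes "u \<in> S_inf" "1 \<le> a"
  shows "dstar u a = sort_at u a"
proof -
  have us: "u \<circ> s a \<in> S_inf" using assms by (intro S_inf_comp s_in_S_inf)
  have "u a \<noteq> u (a + 1)" using assms(1) by (auto simp: S_inf_def bij_def inj_eq)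
  then consider "u a < u (a + 1)" | "u (a + 1) < u a" by linarith
  then show ?thesis
  proof cases
    case 1
    then show ?thesis
      using card_inversions_comp_s[OF assms(1) 1] assms us
      by (auto simp: dstar_def len_eq_card_inversions sort_at_def s_def fun_eq_iff)
  next
    case 2
    then show ?thesis
      using card_inversions_comp_s_descent[OF assms 2] assms us
      by (auto simp: dstar_def len_eq_card_inversions sort_at_def fun_eq_iff)
  qed
qed

lemma dstar_in_S_inf:
  assumes "u \<in> S_inf" "1 \<le> a"
  shows "dstar u a \<in> S_inf"
  using S_inf_comp[OF assms(1) s_in_S_inf[OF assms(2)]] assms(1) by (simp add: dstar_def)

lemma foldl_dstar_eq_sort_at:
  assumes "u \<in> S_inf" "\<forall>a\<in>set ws. 1 \<le> a"
  shows "foldl dstar u ws = foldl sort_at u ws"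
  using assms
proof (induction ws arbitrary: u)
  case (Cons a ws)
  then show ?case using dstar_in_S_inf[of u a] dstar_eq_sort_at[of u a] by simp
qed simp

text \<open>The quantifier ranges over all functions \<open>u\<close>, not just permutations. The
  relation is thus a congruence for concatenation without side conditions, and it satisfies the
  0-Hecke relations.\<close>

definition word_equiv :: "nat list \<Rightarrow> nat list \<Rightarrow> bool" (infix "\<approx>" 50) where
  "xs \<approx> ys \<longleftrightarrow> (\<forall>u. foldl sort_at u xs = foldl sort_at u ys)"

lemma word_equiv_refl [simp]: "xs \<approx> xs"
  by (simp add: word_equiv_def)

lemma word_equiv_sym: "xs \<approx> ys \<Longrightarrow> ys \<approx> xs"
  by (simp add: word_equiv_def)

lemma word_equiv_trans [trans]: "xs \<approx> ys \<Longrightarrow> ys \<approx> zs \<Longrightarrow> xs \<approx> zs"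
  by (simp add: word_equiv_def)

lemma word_equiv_append: "xs \<approx> xs' \<Longrightarrow> ys \<approx> ys' \<Longrightarrow> xs @ ys \<approx> xs' @ ys'"
  by (simp add: word_equiv_def)

lemma word_equiv_Cons: "xs \<approx> ys \<Longrightarrow> a # xs \<approx> a # ys"
  by (simp add: word_equiv_def)

lemma word_equiv_idem: "[a, a] \<approx> [a]"
  by (simp add: word_equiv_def sort_at_def fun_eq_iff)

lemma word_equiv_commute: "a + 2 \<le> b \<or> b + 2 \<le> a \<Longrightarrow> [a, b] \<approx> [b, a]"
  by (auto simp: word_equiv_def sort_at_def fun_eq_iff)

lemma word_equiv_braid: "[a + 1, a, a + 1] \<approx> [a, a + 1, a]"
  by (auto simp: word_equiv_def sort_at_def fun_eq_iff max_def min_def)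

lemma word_equiv_commute_word:
  assumes "\<forall>b\<in>set xs. a + 2 \<le> b \<or> b + 2 \<le> a"
  shows "a # xs \<approx> xs @ [a]"
  using assms
proof (induction xs)
  case (Cons b xs)
  have "[a, b] @ xs \<approx> [b, a] @ xs"
    using Cons.prems by (intro word_equiv_append word_equiv_commute) auto
  also have "[b, a] @ xs = b # (a # xs)" by simp
  also have "\<dots> \<approx> b # (xs @ [a])"
    using Cons by (intro word_equiv_Cons) auto
  finally show ?case by simp
qed simp

lemma word_equiv_commute_words:
  assumes "\<forall>a\<in>set xs. \<forall>b\<in>set ys. a + 2 \<le> b \<or> b + 2 \<le> a"
  shows "xs @ ys \<approx> ys @ xs"
  using assms
proof (induction xs)
  case (Cons a xs)
  have "a # (xs @ ys) \<approx> a # (ys @ xs)"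
    using Cons by (intro word_equiv_Cons) auto
  also have "\<dots> = (a # ys) @ xs" by simp
  also have "\<dots> \<approx> (ys @ [a]) @ xs"
    using Cons.prems by (intro word_equiv_append[OF word_equiv_commute_word]) auto
  finally show ?case by simp
qed simp

section \<open>Reading two adjacent rows by columns\<close>

text \<open>The explicit column bound \<open>n\<close> keeps several rows, and several pipe dreams,
  aligned column by column.\<close>

definition row_word :: "nat \<Rightarrow> nat \<Rightarrow> (nat \<times> nat) set \<Rightarrow> nat list" where
  "row_word r n D = concat (map (\<lambda>c. if (r, c) \<in> D then [r + c - 1] else []) (rev [1..<n]))"

definition col_word :: "nat \<Rightarrow> (nat \<times> nat) set \<Rightarrow> nat \<Rightarrow> nat list" where
  "col_word i D c = (if (i, c) \<in> D then [i + c - 1] else []) @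
                    (if (i + 1, c) \<in> D then [i + c] else [])"

definition cols_word :: "nat \<Rightarrow> (nat \<times> nat) set \<Rightarrow> nat \<Rightarrow> nat \<Rightarrow> nat list" where
  "cols_word i D m n = concat (map (col_word i D) (rev [m..<n]))"

lemma cols_word_split:
  assumes "m \<le> k" "k \<le> n"
  shows "cols_word i D m n = cols_word i D k n @ cols_word i D m k"
proof -
  have "[m..<n] = [m..<k] @ [k..<n]"
    using assms upt_add_eq_append[of m k "n - k"] by simp
  then show ?thesis by (simp add: cols_word_def)
qed

lemma cols_word_Suc: "m \<le> n \<Longrightarrow> cols_word i D m (Suc n) = col_word i D n @ cols_word i D m n"
  by (simp add: cols_word_def)

lemma cols_word_cong:
  assumes "\<And>c. m \<le> c \<Longrightarrow> c < n \<Longrightarrow> (i, c) \<in> D \<longleftrightarrow> (i, c) \<in> E"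
    and "\<And>c. m \<le> c \<Longrightarrow> c < n \<Longrightarrow> (i + 1, c) \<in> D \<longleftrightarrow> (i + 1, c) \<in> E"
  shows "cols_word i D m n = cols_word i E m n"
  unfolding cols_word_def
  by (rule arg_cong[where f = concat], rule map_cong) (use assms in \<open>auto simp: col_word_def\<close>)

text \<open>The braid relation is applied once per full column, and each time the index of the
  travelling generator drops by one. The condition \<open>1 \<le> i + m\<close> keeps the natural
  subtraction from truncating.\<close>

lemma cols_word_full:
  assumes "1 \<le> i + m" "m \<le> n" and "\<And>c. m \<le> c \<Longrightarrow> c < n \<Longrightarrow> (i, c) \<in> D \<and> (i + 1, c) \<in> D"
  shows "(i + n - 1) # cols_word i D m n \<approx> cols_word i D m n @ [i + m - 1]"
  using assms(2,3)
proof (induction n rule: dec_induct)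
  case base
  then show ?case by (simp add: cols_word_def)
next
  case (step n)
  \<comment> \<open>\<open>k\<close> and \<open>k + 1\<close> are the indices of the upper and lower
    cross in column \<open>n\<close>; naming them removes the subtraction.\<close>
  define k where "k = i + n - 1"
  have k: "i + n = k + 1" using assms(1) step.hyps by (simp add: k_def)
  have "(i + Suc n - 1) # cols_word i D m (Suc n) = [k + 1, k, k + 1] @ cols_word i D m n"
    using step k by (simp add: cols_word_Suc col_word_def)
  also have "\<dots> \<approx> [k, k + 1, k] @ cols_word i D m n"
    by (intro word_equiv_append word_equiv_braid) simp
  also have "\<dots> = [k, k + 1] @ (i + n - 1) # cols_word i D m n"
    using k by simp
  also have "\<dots> \<approx> [k, k + 1] @ (cols_word i D m n @ [i + m - 1])"
    using step by (intro word_equiv_append step.IH) auto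
  also have "\<dots> = cols_word i D m (Suc n) @ [i + m - 1]"
    using step k by (simp add: cols_word_Suc col_word_def)
  finally show ?case .
qed

text \<open>Induction on the columns. The lower cross in column \<open>n\<close> has index
  \<open>i + n\<close>, while row \<open>i\<close> to the left of that column has indices at most
  \<open>i + n - 2\<close>, so the two commute.\<close>

lemma row_words_eq_cols_word:
  assumes "1 \<le> i"
  shows "row_word i n D @ row_word (i + 1) n D \<approx> cols_word i D 1 n"
proof (induction n)
  case 0
  then show ?case by (simp add: row_word_def cols_word_def)
next
  case (Suc n)
  show ?case
  proof (cases "n = 0")
    case True
    then show ?thesis by (simp add: row_word_def cols_word_def)
  next
    case False
    define up where "up = (if (i, n) \<in> D then [i + n - 1] else [])"
    define down where "down = (if (i + 1, n) \<in> D then [i + n] else [])"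
    have rows: "row_word i (Suc n) D = up @ row_word i n D"
        "row_word (i + 1) (Suc n) D = down @ row_word (i + 1) n D"
      using False by (simp_all add: row_word_def up_def down_def)
    have "(i + n) # row_word i n D \<approx> row_word i n D @ [i + n]"
      by (rule word_equiv_commute_word) (auto simp: row_word_def split: if_splits)
    then have "row_word i n D @ down \<approx> down @ row_word i n D"
      by (auto simp: down_def intro: word_equiv_sym)
    then have "up @ ((row_word i n D @ down) @ row_word (i + 1) n D) \<approx>
        up @ ((down @ row_word i n D) @ row_word (i + 1) n D)"
      by (rule word_equiv_append[OF word_equiv_refl word_equiv_append[OF _ word_equiv_refl]])
    also have "\<dots> = (up @ down) @ (row_word i n D @ row_word (i + 1) n D)" by simp
    also have "\<dots> \<approx> (up @ down) @ cols_word i D 1 n"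
      by (rule word_equiv_append[OF word_equiv_refl Suc.IH])
    also have "\<dots> = cols_word i D 1 (Suc n)"
      using False by (simp add: cols_word_Suc col_word_def up_def down_def)
    finally show ?thesis using rows by simp
  qed
qed

section \<open>Demazure products from row and column words\<close>

text \<open>Arbitrary bounds \<open>N\<close> and \<open>n\<close> replace those depending on
  \<open>D\<close>, so that two pipe dreams can be read over the same ranges. The additional rows
  and columns contribute empty words.\<close>

lemma reading_word_eq_row_words:
  assumes "pipe_dream D" "\<And>r c. (r, c) \<in> D \<Longrightarrow> r < N \<and> c < n"
  shows "reading_word D = concat (map (\<lambda>r. row_word r n D) [1..<N])"
proof -
  have row: "map (\<lambda>c. r + c - 1) (rev (sorted_list_of_set {c. (r, c) \<in> D})) = row_word r n D" for r
  proof -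
    have "{c. (r, c) \<in> D} = set (filter (\<lambda>c. (r, c) \<in> D) [1..<n])"
      using assms by (fastforce simp: pipe_dream_def)
    then have "sorted_list_of_set {c. (r, c) \<in> D} = filter (\<lambda>c. (r, c) \<in> D) [1..<n]"
      by (simp only: sorted_list_of_set_sort_remdups)
         (simp add: sorted_wrt_filter sort_key_id_if_sorted distinct_remdups_id)
    moreover have "map f (rev (filter P xs)) = concat (map (\<lambda>c. if P c then [f c] else []) (rev xs))"
      for f :: "nat \<Rightarrow> nat" and P xs
      by (induction xs) auto
    ultimately show ?thesis by (simp only: row_word_def)
  qed
  have empty: "row_word r n D = []" if "\<forall>c. (r, c) \<notin> D" for r
    using that by (simp add: row_word_def)
  have finD: "finite D" using assms(1) by (simp add: pipe_dream_def)
  show ?thesis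
  proof (cases "D = {}")
    case True
    \<comment> \<open>For empty \<open>D\<close> the value of \<open>Max\<close> is unspecified, so
      the claim is shown for every list of rows.\<close>
    then have "concat (map (\<lambda>r. row_word r n D) rs) = []" for rs using empty by simp
    then show ?thesis unfolding reading_word_def row by metis
  next
    case False
    let ?M = "Suc (Max (fst ` D))"
    have M: "r < ?M" if "(r, c) \<in> D" for r c
      using that finD by (metis Max_ge finite_imageI fst_conv imageI less_Suc_eq_le)
    have "Max (fst ` D) \<in> fst ` D" using False finD by (intro Max_in) auto
    then have le: "?M \<le> N" using assms(2) by fastforce
    have "[1..<N] = [1..<?M] @ [?M..<N]"
      using le upt_add_eq_append[of 1 ?M "N - ?M"] by simp
    moreover have "concat (map (\<lambda>r. row_word r n D) [?M..<N]) = []"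
      using M empty by (fastforce simp: not_le)
    ultimately show ?thesis unfolding reading_word_def row by simp
  qed
qed

lemma demazure_two_rows:
  assumes "1 \<le> i" "pipe_dream D" "\<And>r c. (r, c) \<in> D \<Longrightarrow> r < N \<and> c < n" "i + 2 \<le> N"
  shows "demazure D =
    foldl sort_at id (concat (map (\<lambda>r. row_word r n D) [1..<i]) @ cols_word i D 1 n @
      concat (map (\<lambda>r. row_word r n D) [i + 2..<N]))"
proof -
  let ?R = "\<lambda>r. row_word r n D"
  have "[1..<N] = [1..<i] @ [i, i + 1] @ [i + 2..<N]"
    using assms(1,4) upt_add_eq_append[of 1 i "N - i"] by (simp add: upt_conv_Cons)
  then have rw: "reading_word D =
      concat (map ?R [1..<i]) @ (?R i @ ?R (i + 1)) @ concat (map ?R [i + 2..<N])"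
    using reading_word_eq_row_words[OF assms(2,3)] by simp
  have pos: "\<forall>a\<in>set (reading_word D). 1 \<le> a"
    using reading_word_eq_row_words[OF assms(2,3)]
    by (auto simp: row_word_def split: if_splits)
  have "demazure D = foldl sort_at id (reading_word D)"
    unfolding demazure_def by (rule foldl_dstar_eq_sort_at[OF id_in_S_inf pos])
  moreover have "reading_word D \<approx>
      concat (map ?R [1..<i]) @ cols_word i D 1 n @ concat (map ?R [i + 2..<N])"
    unfolding rw by (intro word_equiv_append row_words_eq_cols_word assms(1) word_equiv_refl)
  ultimately show ?thesis by (simp add: word_equiv_def)
qed

text \<open>Reduces a comparison of Demazure products to rows \<open>i\<close> and
  \<open>i + 1\<close>. The leftover word \<open>xs\<close> has indices at most \<open>i\<close> and
  the rows from \<open>i + 2\<close> on have indices at least \<open>i + 2\<close>, so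
  \<open>xs\<close> can be moved to the end. The threshold \<open>m\<close> allows \<open>n\<close>
  to be taken beyond all modified columns.\<close>

lemma demazure_eq_if_cols_word_equiv:
  assumes "1 \<le> i" "pipe_dream D" "pipe_dream E"
    and other: "\<And>r c. r \<noteq> i \<Longrightarrow> r \<noteq> i + 1 \<Longrightarrow> (r, c) \<in> D \<longleftrightarrow> (r, c) \<in> E"
    and cols: "\<And>n. m \<le> n \<Longrightarrow> cols_word i D 1 n \<approx> cols_word i E 1 n @ xs"
    and small: "\<forall>x\<in>set xs. x \<le> i"
  shows "demazure D = foldl sort_at (demazure E) xs"
proof -
  have "finite (fst ` (D \<union> E))" "finite (snd ` (D \<union> E))"
    using assms(2,3) by (auto simp: pipe_dream_def)
  then obtain N0 n0 where "\<forall>x\<in>fst ` (D \<union> E). x < N0" "\<forall>x\<in>snd ` (D \<union> E). x < n0"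
    unfolding finite_nat_set_iff_bounded by blast
  then have "r < N0 \<and> c < n0" if "(r, c) \<in> D \<or> (r, c) \<in> E" for r c
    using that by force
  moreover define N where "N = max N0 (i + 2)"
  moreover define n where "n = max n0 m"
  ultimately have bnd: "r < N \<and> c < n" if "(r, c) \<in> D \<or> (r, c) \<in> E" for r c
    using that by (meson less_max_iff_disj)
  have N: "i + 2 \<le> N" and n: "m \<le> n" by (simp_all add: N_def n_def)
  have row: "row_word r n D = row_word r n E" if "r \<noteq> i" "r \<noteq> i + 1" for r
    using other[OF that] by (simp add: row_word_def)
  define pre where "pre = concat (map (\<lambda>r. row_word r n E) [1..<i])"
  define post where "post = concat (map (\<lambda>r. row_word r n E) [i + 2..<N])"
  have "map (\<lambda>r. row_word r n D) [1..<i] = map (\<lambda>r. row_word r n E) [1..<i]"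
    by (rule map_cong) (auto intro!: row)
  moreover have "map (\<lambda>r. row_word r n D) [i + 2..<N] = map (\<lambda>r. row_word r n E) [i + 2..<N]"
    by (rule map_cong) (auto intro!: row)
  ultimately have D: "demazure D = foldl sort_at id (pre @ cols_word i D 1 n @ post)"
    using demazure_two_rows[OF assms(1,2) _ N, of n] bnd unfolding pre_def post_def by metis
  have E: "demazure E = foldl sort_at id (pre @ cols_word i E 1 n @ post)"
    using demazure_two_rows[OF assms(1,3) _ N, of n] bnd unfolding pre_def post_def by blast
  have "cols_word i D 1 n @ post \<approx> (cols_word i E 1 n @ xs) @ post"
    by (rule word_equiv_append[OF cols[OF n] word_equiv_refl])
  also have "\<dots> = cols_word i E 1 n @ (xs @ post)" by simp
  also have "\<dots> \<approx> cols_word i E 1 n @ (post @ xs)"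
  proof (rule word_equiv_append[OF word_equiv_refl word_equiv_commute_words])
    have "i + 2 \<le> b" if "b \<in> set post" for b
      using that by (auto simp: post_def row_word_def split: if_splits)
    then show "\<forall>a\<in>set xs. \<forall>b\<in>set post. a + 2 \<le> b \<or> b + 2 \<le> a"
      using small by fastforce
  qed
  finally show ?thesis
    unfolding D E by (simp add: word_equiv_def)
qed

section \<open>Mitosis\<close>

lemma start_props:
  assumes "finite D"
  shows "1 \<le> start i D" "(i, start i D) \<notin> D" "\<And>c. 1 \<le> c \<Longrightarrow> c < start i D \<Longrightarrow> (i, c) \<in> D"
proof -
  have "finite (snd ` D)" using assms by simp
  then obtain n where "\<forall>x\<in>snd ` D. x < n" unfolding finite_nat_set_iff_bounded by blast
  then have ex: "1 \<le> n + 1 \<and> (i, n + 1) \<notin> D" by force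
  show "1 \<le> start i D" "(i, start i D) \<notin> D"
    unfolding start_def using LeastI[of "\<lambda>c. 1 \<le> c \<and> (i, c) \<notin> D", OF ex] by auto
  show "(i, c) \<in> D" if "1 \<le> c" "c < start i D" for c
    using that not_less_Least unfolding start_def by blast
qed

lemma start_eqI:
  assumes "1 \<le> k" "(i, k) \<notin> D" "\<And>c. 1 \<le> c \<Longrightarrow> c < k \<Longrightarrow> (i, c) \<in> D"
  shows "start i D = k"
  unfolding start_def by (rule Least_equality) (use assms in \<open>auto simp: not_less[symmetric]\<close>)

lemma finite_J [simp]: "finite (J i D)"
  by (rule finite_subset[of _ "{..<start i D}"]) (auto simp: J_def)

lemma J_props:
  assumes "finite D" "p \<in> J i D"
  shows "1 \<le> p" "p < start i D" "(i, p) \<in> D" "(Suc i, p) \<notin> D"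
  using assms start_props(3)[OF assms(1)] by (auto simp: J_def)

lemma not_J_full:
  assumes "finite D" "c \<notin> J i D" "1 \<le> c" "c < start i D"
  shows "(i, c) \<in> D" "(Suc i, c) \<in> D"
  using assms start_props(3)[OF assms(1)] by (auto simp: J_def)

lemma mem_Dp [simp]:
  "(i, c) \<in> Dp i D p \<longleftrightarrow> (i, c) \<in> D \<and> c \<noteq> p \<and> \<not> (c \<in> J i D \<and> c < p)"
  "(Suc i, c) \<in> Dp i D p \<longleftrightarrow> (Suc i, c) \<in> D \<or> c \<in> J i D \<and> c < p"
  "r \<noteq> i \<Longrightarrow> r \<noteq> Suc i \<Longrightarrow> (r, c) \<in> Dp i D p \<longleftrightarrow> (r, c) \<in> D"
  by (auto simp: Dp_def)

lemma row_set_eqI: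
  assumes "\<And>c. (i, c) \<in> A \<longleftrightarrow> (i, c) \<in> B" "\<And>c. (Suc i, c) \<in> A \<longleftrightarrow> (Suc i, c) \<in> B"
    "\<And>r c. r \<noteq> i \<Longrightarrow> r \<noteq> Suc i \<Longrightarrow> (r, c) \<in> A \<longleftrightarrow> (r, c) \<in> B"
  shows "A = B"
  using assms by (metis set_eqI surj_pair)

text \<open>With no element of \<open>J i D\<close> strictly between \<open>p\<close> and
  \<open>q\<close>, the only cross of \<open>Dp i D p\<close> missing from \<open>Dp i D q\<close>
  is \<open>(i, q)\<close>.\<close>

lemma Dp_Un_Dp:
  assumes "finite D" "p \<in> J i D" "q \<in> J i D" "p < q" "\<not> (\<exists>r\<in>J i D. p < r \<and> r < q)"
  shows "Dp i D p \<union> Dp i D q = insert (i, q) (Dp i D q)"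
proof (rule row_set_eqI[of i])
  show "(i, c) \<in> Dp i D p \<union> Dp i D q \<longleftrightarrow> (i, c) \<in> insert (i, q) (Dp i D q)" for c
    using assms J_props[OF assms(1,3)] by (auto simp: not_less)
qed (use assms in auto)

lemma J_predecessor:
  assumes "q \<in> J i D" "q \<noteq> Min (J i D)"
  obtains p where "p \<in> J i D" "p < q" "\<not> (\<exists>r\<in>J i D. p < r \<and> r < q)"
proof -
  let ?A = "{p \<in> J i D. p < q}"
  have "Min (J i D) \<in> ?A"
    using assms by (metis (mono_tags, lifting) Min_in Min_le empty_iff finite_J le_neq_implies_less mem_Collect_eq)
  then have "Max ?A \<in> ?A" by (intro Max_in) auto
  moreover have "\<not> (\<exists>r\<in>J i D. Max ?A < r \<and> r < q)"
    using Max_ge[of ?A] by (auto simp: not_less[symmetric])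
  ultimately show ?thesis using that by blast
qed

text \<open>Indexing each union by its larger element \<open>q\<close> describes every member by one
  \<open>q\<close> and the presence or absence of \<open>(i, q)\<close>. The minimum has no
  predecessor and hence gives no union.\<close>

lemma mitosis'_eq:
  assumes "finite D"
  shows "mitosis' i D =
    Dp i D ` J i D \<union> {insert (i, q) (Dp i D q) | q. q \<in> J i D \<and> q \<noteq> Min (J i D)}"
proof -
  have "{Dp i D p \<union> Dp i D q | p q. p \<in> J i D \<and> q \<in> J i D \<and> p < q \<and>
          \<not> (\<exists>r\<in>J i D. p < r \<and> r < q)} =
        {insert (i, q) (Dp i D q) | q. q \<in> J i D \<and> q \<noteq> Min (J i D)}" (is "?L = ?R")
  proof
    show "?L \<subseteq> ?R"
    proof
      fix E assume "E \<in> ?L"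
      then obtain p q where pq: "E = Dp i D p \<union> Dp i D q" "p \<in> J i D" "q \<in> J i D" "p < q"
        "\<not> (\<exists>r\<in>J i D. p < r \<and> r < q)" by blast
      then have "E = insert (i, q) (Dp i D q)" using Dp_Un_Dp[OF assms] by blast
      moreover have "q \<noteq> Min (J i D)" using pq by (metis Min_le finite_J not_le)
      ultimately show "E \<in> ?R" using pq by blast
    qed
    show "?R \<subseteq> ?L"
    proof
      fix E assume "E \<in> ?R"
      then obtain q where q: "E = insert (i, q) (Dp i D q)" "q \<in> J i D" "q \<noteq> Min (J i D)" by blast
      obtain p where "p \<in> J i D" "p < q" "\<not> (\<exists>r\<in>J i D. p < r \<and> r < q)"
        using J_predecessor q by blast
      with q Dp_Un_Dp[OF assms] show "E \<in> ?L" by blast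
    qed
  qed
  then show ?thesis by (simp add: mitosis'_def)
qed

lemma mitosis'_cases:
  assumes "finite D" "E \<in> mitosis' i D"
  obtains q where "q \<in> J i D" "E = Dp i D q"
  | q where "q \<in> J i D" "q \<noteq> Min (J i D)" "E = insert (i, q) (Dp i D q)"
  using assms(2) unfolding mitosis'_eq[OF assms(1)] by blast

lemma pipe_dream_Dp:
  assumes "pipe_dream D" "p \<in> J i D"
  shows "pipe_dream (Dp i D p)"
proof -
  have "Dp i D p \<subseteq> D \<union> {i + 1} \<times> J i D" by (auto simp: Dp_def)
  moreover have "pipe_dream (D \<union> {i + 1} \<times> J i D)"
    using assms(1) by (auto simp: pipe_dream_def J_def)
  ultimately show ?thesis
    unfolding pipe_dream_def by (meson finite_subset subset_iff)
qed

lemma pipe_dream_mitosis':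
  assumes "1 \<le> i" "pipe_dream D" "E \<in> mitosis' i D"
  shows "pipe_dream E"
proof -
  have fin: "finite D" using assms(2) by (simp add: pipe_dream_def)
  show ?thesis
    using fin assms(3)
  proof (cases rule: mitosis'_cases)
    case (1 q)
    then show ?thesis using pipe_dream_Dp assms(2) by blast
  next
    case (2 q)
    then show ?thesis
      using pipe_dream_Dp[OF assms(2)] J_props(1)[OF fin] assms(1) by (simp add: pipe_dream_def)
  qed
qed

section \<open>Demazure products under mitosis\<close>

text \<open>The columns strictly between \<open>p\<close> and \<open>q\<close> are full. Pushing the
  generator of \<open>(i, q)\<close> through them turns it into that of \<open>(i + 1, p)\<close>,
  which gives the first equality. With both crosses present the generator appears twice in a row,
  and idempotence gives the second.\<close>

lemma demazure_Dp_chute: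
  assumes "1 \<le> i" "pipe_dream D" "p \<in> J i D" "q \<in> J i D" "p < q"
    and gap: "\<not> (\<exists>r\<in>J i D. p < r \<and> r < q)"
  shows "demazure (Dp i D p) = demazure (Dp i D q)"
    and "demazure (insert (i, q) (Dp i D q)) = demazure (Dp i D q)"
proof -
  have fin: "finite D" using assms(2) by (simp add: pipe_dream_def)
  note Jp = J_props[OF fin assms(3)] and Jq = J_props[OF fin assms(4)]
  let ?X = "Dp i D q"
  have pd: "pipe_dream (Dp i D p)" "pipe_dream ?X" "pipe_dream (insert (i, q) ?X)"
    using pipe_dream_Dp[OF assms(2)] assms(1,3,4) Jq by (auto simp: pipe_dream_def)
  have split: "cols_word i Y 1 n = cols_word i Y (q + 1) n @ col_word i Y q @
      cols_word i Y (p + 1) q @ col_word i Y p @ cols_word i Y 1 p" if "q < n" for n Y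
  proof -
    have "cols_word i Y 1 n = cols_word i Y (q + 1) n @ cols_word i Y 1 (q + 1)"
      using that by (intro cols_word_split) auto
    also have "cols_word i Y 1 (q + 1) = col_word i Y q @ cols_word i Y 1 q"
      using Jq(1) by (simp add: cols_word_Suc)
    also have "cols_word i Y 1 q = cols_word i Y (p + 1) q @ cols_word i Y 1 (p + 1)"
      using assms(5) by (intro cols_word_split) auto
    also have "cols_word i Y 1 (p + 1) = col_word i Y p @ cols_word i Y 1 p"
      using Jp(1) by (simp add: cols_word_Suc)
    finally show ?thesis by simp
  qed
  define F where "F = cols_word i ?X (p + 1) q"
  have F: "(i + q - 1) # F \<approx> F @ [i + p]"
  proof -
    have "(i, c) \<in> ?X \<and> (i + 1, c) \<in> ?X" if "p + 1 \<le> c" "c < q" for c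
    proof -
      have "c \<notin> J i D" using that gap by auto
      then show ?thesis using not_J_full[OF fin, of c i] that Jq by auto
    qed
    then have "(i + q - 1) # F \<approx> F @ [i + (p + 1) - 1]"
      unfolding F_def using assms(5) by (intro cols_word_full) auto
    then show ?thesis by simp
  qed
  have mid: "cols_word i (Dp i D p) (p + 1) q = F" "cols_word i (insert (i, q) ?X) (p + 1) q = F"
    unfolding F_def using gap by (auto intro!: cols_word_cong)
  have right: "cols_word i (Dp i D p) (q + 1) n = cols_word i ?X (q + 1) n"
      "cols_word i (insert (i, q) ?X) (q + 1) n = cols_word i ?X (q + 1) n" for n
    using assms(5) by (auto intro!: cols_word_cong)
  have left: "cols_word i (Dp i D p) 1 p = cols_word i ?X 1 p"
      "cols_word i (insert (i, q) ?X) 1 p = cols_word i ?X 1 p"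
    using assms(5) by (auto intro!: cols_word_cong)
  have col: "col_word i (Dp i D p) q = [i + q - 1]" "col_word i (Dp i D p) p = []"
      "col_word i ?X q = []" "col_word i ?X p = [i + p]"
      "col_word i (insert (i, q) ?X) q = [i + q - 1]" "col_word i (insert (i, q) ?X) p = [i + p]"
    using Jp Jq assms(3-5) by (auto simp: col_word_def)
  \<comment> \<open>The columns right of \<open>q\<close> and left of \<open>p\<close> are common
    factors, so only the columns from \<open>p\<close> to \<open>q\<close> have to be
    compared.\<close>
  have ctx: "cols_word i Y 1 n \<approx> cols_word i ?X 1 n @ []"
    if "q < n" "cols_word i Y (q + 1) n = cols_word i ?X (q + 1) n"
      "cols_word i Y 1 p = cols_word i ?X 1 p" "cols_word i Y (p + 1) q = F"
      "col_word i Y q @ F @ col_word i Y p \<approx> F @ [i + p]" for Y n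
  proof -
    have "cols_word i ?X (q + 1) n @ ((col_word i Y q @ F @ col_word i Y p) @ cols_word i ?X 1 p)
        \<approx> cols_word i ?X (q + 1) n @ ((F @ [i + p]) @ cols_word i ?X 1 p)"
      by (rule word_equiv_append[OF word_equiv_refl word_equiv_append[OF that(5) word_equiv_refl]])
    then show ?thesis
      using split[OF that(1), of Y] split[OF that(1), of ?X] that(2-4) col(3,4) F_def by simp
  qed
  have "demazure (Dp i D p) = foldl sort_at (demazure ?X) []"
  proof (rule demazure_eq_if_cols_word_equiv[OF assms(1) pd(1,2), where m = "q + 1"])
    show "cols_word i (Dp i D p) 1 n \<approx> cols_word i ?X 1 n @ []" if "q + 1 \<le> n" for n
      using that F by (intro ctx right left mid) (simp_all add: col)
  qed auto
  then show "demazure (Dp i D p) = demazure ?X" by simp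
  have "demazure (insert (i, q) ?X) = foldl sort_at (demazure ?X) []"
  proof (rule demazure_eq_if_cols_word_equiv[OF assms(1) pd(3,2), where m = "q + 1"])
    have "((i + q - 1) # F) @ [i + p] \<approx> (F @ [i + p]) @ [i + p]"
      by (rule word_equiv_append[OF F word_equiv_refl])
    also have "\<dots> = F @ [i + p, i + p]" by simp
    also have "\<dots> \<approx> F @ [i + p]"
      by (rule word_equiv_append[OF word_equiv_refl word_equiv_idem])
    finally have "((i + q - 1) # F) @ [i + p] \<approx> F @ [i + p]" .
    then show "cols_word i (insert (i, q) ?X) 1 n \<approx> cols_word i ?X 1 n @ []" if "q + 1 \<le> n" for n
      using that by (intro ctx right left mid) (simp_all add: col)
  qed auto
  then show "demazure (insert (i, q) ?X) = demazure ?X" by simp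
qed

text \<open>At the minimum \<open>p\<close> nothing is moved down and only \<open>(i, p)\<close> is
  deleted. All columns to its left are full, so its generator leaves the two rows as
  \<open>i\<close>.\<close>

lemma demazure_Dp_Min:
  assumes "1 \<le> i" "pipe_dream D" "J i D \<noteq> {}"
  shows "demazure D = sort_at (demazure (Dp i D (Min (J i D)))) i"
proof -
  define p where "p = Min (J i D)"
  have p: "p \<in> J i D" using assms(3) by (simp add: p_def)
  have notJ: "c \<notin> J i D" if "c < p" for c
    using that by (metis Min_le finite_J not_le p_def)
  have fin: "finite D" using assms(2) by (simp add: pipe_dream_def)
  note Jp = J_props[OF fin p]
  let ?X = "Dp i D p"
  have split: "cols_word i Y 1 n = cols_word i Y (p + 1) n @ col_word i Y p @ cols_word i Y 1 p"
    if "p < n" for n Y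
  proof -
    have "cols_word i Y 1 n = cols_word i Y (p + 1) n @ cols_word i Y 1 (p + 1)"
      using that by (intro cols_word_split) auto
    then show ?thesis using Jp(1) by (simp add: cols_word_Suc)
  qed
  define F where "F = cols_word i ?X 1 p"
  have F: "(i + p - 1) # F \<approx> F @ [i]"
  proof -
    have "(i, c) \<in> ?X \<and> (i + 1, c) \<in> ?X" if "1 \<le> c" "c < p" for c
      using not_J_full[OF fin notJ] notJ that Jp by auto
    then have "(i + p - 1) # F \<approx> F @ [i + 1 - 1]"
      unfolding F_def using Jp(1) by (intro cols_word_full) auto
    then show ?thesis by simp
  qed
  have left: "cols_word i D 1 p = F"
    unfolding F_def using notJ by (auto intro!: cols_word_cong)
  have right: "cols_word i D (p + 1) n = cols_word i ?X (p + 1) n" for n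
    by (auto intro!: cols_word_cong)
  have col: "col_word i D p = [i + p - 1]" "col_word i ?X p = []"
    using Jp by (auto simp: col_word_def)
  have "demazure D = foldl sort_at (demazure ?X) [i]"
  proof (rule demazure_eq_if_cols_word_equiv[OF assms(1,2) pipe_dream_Dp[OF assms(2) p],
        where m = "p + 1"])
    show "cols_word i D 1 n \<approx> cols_word i ?X 1 n @ [i]" if "p + 1 \<le> n" for n
      using word_equiv_append[OF word_equiv_refl F, of "cols_word i ?X (p + 1) n"] that
        split[of n D] split[of n ?X] left right col F_def by simp
  qed auto
  then show ?thesis by (simp add: p_def)
qed

text \<open>Passes from \<open>q\<close> to its predecessor in \<open>J i D\<close> until the
  minimum is reached.\<close>

lemma demazure_Dp_eq:
  assumes "1 \<le> i" "pipe_dream D" "q \<in> J i D"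
  shows "demazure (Dp i D q) = demazure (Dp i D (Min (J i D)))"
  using assms(3)
proof (induction q rule: less_induct)
  case (less q)
  show ?case
  proof (cases "q = Min (J i D)")
    case False
    then obtain p where p: "p \<in> J i D" "p < q" "\<not> (\<exists>r\<in>J i D. p < r \<and> r < q)"
      using J_predecessor less.prems by blast
    then show ?thesis
      using demazure_Dp_chute(1)[OF assms(1,2) p(1) less.prems p(2,3)] less.IH by simp
  qed simp
qed

lemma demazure_mitosis':
  assumes "1 \<le> i" "pipe_dream D" "E \<in> mitosis' i D"
  shows "demazure E = demazure (Dp i D (Min (J i D)))"
proof -
  have fin: "finite D" using assms(2) by (simp add: pipe_dream_def)
  show ?thesis
    using fin assms(3)
  proof (cases rule: mitosis'_cases)
    case (1 q)
    then show ?thesis using demazure_Dp_eq assms by blast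
  next
    case (2 q)
    then obtain p where p: "p \<in> J i D" "p < q" "\<not> (\<exists>r\<in>J i D. p < r \<and> r < q)"
      using J_predecessor by blast
    show ?thesis
      using demazure_Dp_chute(2)[OF assms(1,2) p(1) 2(1) p(2,3)] demazure_Dp_eq[OF assms(1,2) 2(1)]
        2(3) by simp
  qed
qed

section \<open>Inverting the enlarged mitosis\<close>

text \<open>Every member of \<open>mitosis' i D\<close> has its first gap in row \<open>i\<close> at
  the minimum of \<open>J i D\<close>, and all columns before it are full.\<close>

lemma J_mitosis':
  assumes "finite D" "E \<in> mitosis' i D"
  shows "J i E = {}"
proof -
  define m where "m = Min (J i D)"
  have ne: "J i D \<noteq> {}" using assms(2) by (auto simp: mitosis'_def)
  then have m: "m \<in> J i D" by (simp add: m_def)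
  have notJ: "c \<notin> J i D" if "c < m" for c
    using that by (metis Min_le finite_J not_le m_def)
  have le: "m \<le> q" if "q \<in> J i D" for q using that notJ not_le by blast
  note Jm = J_props[OF assms(1) m]
  have full: "(i, c) \<in> D \<and> (Suc i, c) \<in> D" if "1 \<le> c" "c < m" for c
    using not_J_full[OF assms(1) notJ] that Jm by auto
  have E: "(i, m) \<notin> E \<and> (\<forall>c. 1 \<le> c \<longrightarrow> c < m \<longrightarrow> (i, c) \<in> E \<and> (Suc i, c) \<in> E)"
    using assms
  proof (cases rule: mitosis'_cases)
    case (1 q)
    then show ?thesis using le[of q] m full notJ by auto
  next
    case (2 q)
    \<comment> \<open>The added cross \<open>(i, q)\<close> therefore does not fill the gap at
      \<open>m\<close>.\<close>
    then have "m < q" using le[of q] m_def by linarith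
    then show ?thesis using 2(3) m full notJ by auto
  qed
  then have "start i E = m" using Jm by (intro start_eqI) auto
  then show ?thesis using E by (auto simp: J_def)
qed

text \<open>If E lies in mitosis' i D, then for the first gap q of E in row i + 1, E is Dp i D q with or
without the cross (i, q) added; row i is unchanged to the right of q, so its next gap a in E is
the start of D.\<close>

definition unmitosis :: "nat \<Rightarrow> (nat \<times> nat) set \<Rightarrow> (nat \<times> nat) set" where
  "unmitosis i E =
    (let q = start (i + 1) E; a = (LEAST c. q < c \<and> (i, c) \<notin> E)
     in (E \<union> {(i, c) | c. 1 \<le> c \<and> c < a}) - {(i + 1, c) | c. 1 \<le> c \<and> c < q \<and> (i, c) \<notin> E})"

lemma mem_unmitosis:
  assumes "q = start (i + 1) E" "a = (LEAST c. q < c \<and> (i, c) \<notin> E)"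
  shows "(i, c) \<in> unmitosis i E \<longleftrightarrow> (i, c) \<in> E \<or> 1 \<le> c \<and> c < a"
    and "(Suc i, c) \<in> unmitosis i E \<longleftrightarrow> (Suc i, c) \<in> E \<and> \<not> (1 \<le> c \<and> c < q \<and> (i, c) \<notin> E)"
    and "r \<noteq> i \<Longrightarrow> r \<noteq> Suc i \<Longrightarrow> (r, c) \<in> unmitosis i E \<longleftrightarrow> (r, c) \<in> E"
  using assms by (auto simp: unmitosis_def Let_def)

text \<open>This left inverse gives disjointness: a member of \<open>mitosis' i D\<close> determines
  \<open>D\<close>.\<close>

lemma unmitosis_mitosis':
  assumes "finite D" "E \<in> mitosis' i D"
  shows "unmitosis i E = D"
proof -
  \<comment> \<open>Both kinds of members agree away from the cell \<open>(i, q)\<close>, so the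
    description leaves that cell open.\<close>
  obtain q where q: "q \<in> J i D"
    and r1: "\<And>c. (Suc i, c) \<in> E \<longleftrightarrow> (Suc i, c) \<in> D \<or> c \<in> J i D \<and> c < q"
    and r0: "\<And>c. c \<noteq> q \<Longrightarrow> (i, c) \<in> E \<longleftrightarrow> (i, c) \<in> D \<and> \<not> (c \<in> J i D \<and> c < q)"
    and other: "\<And>r c. r \<noteq> i \<Longrightarrow> r \<noteq> Suc i \<Longrightarrow> (r, c) \<in> E \<longleftrightarrow> (r, c) \<in> D"
    using assms
  proof (cases rule: mitosis'_cases)
    case (1 q)
    then show ?thesis using that[of q] by simp
  next
    case (2 q)
    then show ?thesis using that[of q] by simp
  qed
  note Jq = J_props[OF assms(1) q]
  have s: "q = start (i + 1) E"
  proof (rule start_eqI[symmetric])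
    show "(i + 1, c) \<in> E" if "1 \<le> c" "c < q" for c
      using not_J_full(2)[OF assms(1), of c i] that Jq r1 by auto
  qed (use Jq r1 in auto)
  have a: "start i D = (LEAST c. q < c \<and> (i, c) \<notin> E)"
  proof (rule Least_equality[symmetric])
    show "q < start i D \<and> (i, start i D) \<notin> E"
      using Jq r0[of "start i D"] start_props(2)[OF assms(1)] by auto
    show "start i D \<le> c" if "q < c \<and> (i, c) \<notin> E" for c
      using that r0[of c] start_props(3)[OF assms(1), of c i] by (auto simp: not_less[symmetric])
  qed
  note mem = mem_unmitosis[OF s a]
  have below: "(i, c) \<in> D" if "1 \<le> c" "c < start i D" for c
    using start_props(3)[OF assms(1)] that .
  show ?thesis
  proof (rule row_set_eqI[of i])
    show "(i, c) \<in> unmitosis i E \<longleftrightarrow> (i, c) \<in> D" for c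
    proof (cases "1 \<le> c \<and> c < start i D")
      case True
      then show ?thesis using mem(1) below by auto
    next
      case False
      then have "c \<noteq> q" "c \<notin> J i D" using Jq J_props[OF assms(1)] by auto
      then show ?thesis using False r0 unfolding mem(1) by auto
    qed
    show "(Suc i, c) \<in> unmitosis i E \<longleftrightarrow> (Suc i, c) \<in> D" for c
    proof (cases "c \<in> J i D \<and> c < q")
      case True
      then show ?thesis unfolding mem(2) r1 using r0[of c] J_props[OF assms(1)] by auto
    next
      case False
      then show ?thesis
        unfolding mem(2) r1 using r0[of c] below[of c] Jq by auto
    qed
    show "(r, c) \<in> unmitosis i E \<longleftrightarrow> (r, c) \<in> D" if "r \<noteq> i" "r \<noteq> Suc i" for r c
      using mem(3)[OF that] other[OF that] by simp
  qed
qed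

text \<open>Here the emptiness of \<open>J i E\<close> matters when \<open>(i, q)\<close> is a cross
  of \<open>E\<close>: it provides an element of \<open>J i D\<close> below
  \<open>q\<close>.\<close>

lemma mitosis'_unmitosis:
  assumes "1 \<le> i" "pipe_dream E" "J i E = {}"
  shows "pipe_dream (unmitosis i E) \<and> E \<in> mitosis' i (unmitosis i E)"
proof -
  define q where "q = start (i + 1) E"
  define a where "a = (LEAST c. q < c \<and> (i, c) \<notin> E)"
  define D where "D = unmitosis i E"
  have fin: "finite E" and pos: "\<And>r c. (r, c) \<in> E \<Longrightarrow> 1 \<le> r \<and> 1 \<le> c"
    using assms(2) by (auto simp: pipe_dream_def)
  note mem = mem_unmitosis[OF q_def a_def, folded D_def]
  have q: "1 \<le> q" "(Suc i, q) \<notin> E" "\<And>c. 1 \<le> c \<Longrightarrow> c < q \<Longrightarrow> (Suc i, c) \<in> E"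
    using start_props[OF fin, where i = "i + 1"] by (auto simp: q_def)
  have "finite (snd ` E)" using fin by simp
  then obtain n where "\<forall>x\<in>snd ` E. x < n" unfolding finite_nat_set_iff_bounded by blast
  \<comment> \<open>All crosses lie in columns below \<open>n\<close>, so there is a gap to the
    right of \<open>q\<close> and the \<open>LEAST\<close> defining \<open>a\<close> is
    attained.\<close>
  then have ex: "q < q + n + 1 \<and> (i, q + n + 1) \<notin> E" by force
  have a: "q < a" "(i, a) \<notin> E"
    using LeastI[of "\<lambda>c. q < c \<and> (i, c) \<notin> E", OF ex] by (auto simp: a_def)
  have a_least: "(i, c) \<in> E" if "q < c" "c < a" for c
    using that not_less_Least unfolding a_def by blast
  have "unmitosis i E \<subseteq> E \<union> {i} \<times> {1..<a}"
    using a_def q_def by (auto simp: unmitosis_def Let_def)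
  moreover have "pipe_dream (E \<union> {i} \<times> {1..<a})"
    using assms(1,2) by (auto simp: pipe_dream_def)
  ultimately have pd: "pipe_dream D"
    unfolding D_def pipe_dream_def by (meson finite_subset subset_iff)
  then have finD: "finite D" by (simp add: pipe_dream_def)
  have startD: "start i D = a"
    using a q by (intro start_eqI) (auto simp: mem)
  have J: "c \<in> J i D \<longleftrightarrow> 1 \<le> c \<and> c < a \<and> ((Suc i, c) \<notin> E \<or> c < q \<and> (i, c) \<notin> E)" for c
    unfolding J_def startD by (auto simp: mem)
  \<comment> \<open>To the left of \<open>q\<close>, the gaps of \<open>E\<close> in row
    \<open>i\<close> are exactly the places from which a cross was moved down.\<close>
  have J_less: "c \<in> J i D \<longleftrightarrow> 1 \<le> c \<and> (i, c) \<notin> E" if "c < q" for c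
    using that q(3) a(1) by (auto simp: J)
  have Jq: "q \<in> J i D" using q a by (simp add: J)
  \<comment> \<open>The cell \<open>(i, q)\<close> decides whether \<open>E\<close> is a single
    offspring or a union of two consecutive ones.\<close>
  have "E \<in> mitosis' i D"
  proof (cases "(i, q) \<in> E")
    case False
    have "E = Dp i D q"
    proof (rule row_set_eqI[of i])
      show "(i, c) \<in> E \<longleftrightarrow> (i, c) \<in> Dp i D q" for c
        using False J_less[of c] a_least[of c] pos[of i c]
        by (cases c q rule: linorder_cases) (auto simp: mem)
      show "(Suc i, c) \<in> E \<longleftrightarrow> (Suc i, c) \<in> Dp i D q" for c
        using J_less[of c] q(3)[of c] by (cases "c < q") (auto simp: mem)
      show "(r, c) \<in> E \<longleftrightarrow> (r, c) \<in> Dp i D q" if "r \<noteq> i" "r \<noteq> Suc i" for r c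
        using that by (simp add: mem(3))
    qed
    then show ?thesis unfolding mitosis'_eq[OF finD] using Jq by blast
  next
    case True
    have "E = insert (i, q) (Dp i D q)"
    proof (rule row_set_eqI[of i])
      show "(i, c) \<in> E \<longleftrightarrow> (i, c) \<in> insert (i, q) (Dp i D q)" for c
        using True J_less[of c] a_least[of c] pos[of i c]
        by (cases c q rule: linorder_cases) (auto simp: mem)
      show "(Suc i, c) \<in> E \<longleftrightarrow> (Suc i, c) \<in> insert (i, q) (Dp i D q)" for c
        using J_less[of c] q(3)[of c] by (cases "c < q") (auto simp: mem)
      show "(r, c) \<in> E \<longleftrightarrow> (r, c) \<in> insert (i, q) (Dp i D q)" if "r \<noteq> i" "r \<noteq> Suc i" for r c
        using that by (simp add: mem(3))
    qed
    moreover have "q \<noteq> Min (J i D)"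
    proof -
      \<comment> \<open>The first gap of \<open>E\<close> in row \<open>i\<close> must precede
        \<open>q\<close>, since otherwise \<open>q\<close> would belong to
        \<open>J i E\<close>.\<close>
      let ?j = "start i E"
      have j: "1 \<le> ?j" "(i, ?j) \<notin> E" using start_props[OF fin] by auto
      have "?j \<le> q"
      proof (rule ccontr)
        assume "\<not> ?j \<le> q"
        then have "q \<in> J i E" using q by (simp add: J_def)
        then show False using assms(3) by simp
      qed
      then have "?j < q" using j True by (metis le_neq_implies_less)
      then have "?j \<in> J i D" using J_less j by simp
      then show ?thesis using \<open>?j < q\<close> by (metis Min_le finite_J not_le)
    qed
    ultimately show ?thesis unfolding mitosis'_eq[OF finD] using Jq by blast
  qed
  then show ?thesis using pd by (simp add: D_def)
qed

section \<open>The two disjoint decompositions\<close>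

theorem theorem4p1:
  fixes w :: "nat \<Rightarrow> nat" and i :: nat
  assumes "w \<in> S_inf" and "1 \<le> i" and "len (w \<circ> s i) + 1 = len w"
  shows "disjoint_family_on (mitosis' i) (P_s w i) \<and>
         (\<Union>D\<in>P_s w i. mitosis' i D) = PD (w \<circ> s i) \<and>
         disjoint_family_on (mitosis' i) (P_I w i) \<and>
         (\<Union>D\<in>P_I w i. mitosis' i D) = P_empty w i"
proof -
  have ws: "w \<circ> s i \<in> S_inf" using assms by (intro S_inf_comp s_in_S_inf)
  have "(w \<circ> s i) \<circ> s i = w" by (simp add: fun_eq_iff)
  then have "dstar (w \<circ> s i) i = w" using assms(3) by (simp add: dstar_def)
  then have sort_ws: "sort_at (w \<circ> s i) i = w" using dstar_eq_sort_at[OF ws assms(2)] by simp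
  have "dstar w i = w" using assms(3) by (simp add: dstar_def)
  then have sort_w: "sort_at w i = w" using dstar_eq_sort_at[OF assms(1,2)] by simp
  have ws_neq: "w \<circ> s i \<noteq> w" using assms(3) by auto
  have disj: "disjoint_family_on (mitosis' i) X" if "X \<subseteq> {D. finite D}" for X
    unfolding disjoint_family_on_def using that unmitosis_mitosis' by blast
  have fin: "P_s w i \<subseteq> {D. finite D}" "P_I w i \<subseteq> {D. finite D}"
    by (auto simp: P_s_def P_I_def PD_def pipe_dream_def)
  \<comment> \<open>Taking \<open>v\<close> to be \<open>w \<circ> s i\<close> or \<open>w\<close>
    serves both statements. All members of \<open>mitosis' i D\<close> share one Demazure product,
    so knowing it for the minimal offspring suffices.\<close>
  have up: "E \<in> PD v" if "D \<in> PD w" "mitosis i D \<subseteq> PD v" "E \<in> mitosis' i D" for D E v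
  proof -
    have pd: "pipe_dream D" using that(1) by (simp add: PD_def)
    have "J i D \<noteq> {}" using that(3) by (auto simp: mitosis'_def)
    then have "Dp i D (Min (J i D)) \<in> PD v"
      using that(2) Min_in[OF finite_J] unfolding mitosis_def by blast
    then show ?thesis
      using demazure_mitosis'[OF assms(2) pd that(3)] pipe_dream_mitosis'[OF assms(2) pd that(3)]
      by (simp add: PD_def)
  qed
  \<comment> \<open>The condition \<open>sort_at v i = w\<close> holds for both choices of
    \<open>v\<close>; it turns the Demazure product \<open>v\<close> of the offspring into
    \<open>w\<close> for the parent.\<close>
  have down: "unmitosis i E \<in> PD w \<and> J i (unmitosis i E) \<noteq> {} \<and>
      mitosis i (unmitosis i E) \<subseteq> PD v \<and> E \<in> mitosis' i (unmitosis i E)"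
    if "E \<in> PD v" "J i E = {}" "sort_at v i = w" for E v
  proof -
    define D where "D = unmitosis i E"
    have E: "pipe_dream E" "demazure E = v" using that(1) by (auto simp: PD_def)
    have D: "pipe_dream D" "E \<in> mitosis' i D"
      using mitosis'_unmitosis[OF assms(2) E(1) that(2)] by (auto simp: D_def)
    have ne: "J i D \<noteq> {}" using D(2) by (auto simp: mitosis'_def)
    have Min: "demazure (Dp i D (Min (J i D))) = v"
      using demazure_mitosis'[OF assms(2) D] E by simp
    then have "D \<in> PD w"
      using demazure_Dp_Min[OF assms(2) D(1) ne] that(3) D(1) by (simp add: PD_def)
    moreover have "mitosis i D \<subseteq> PD v"
      using demazure_Dp_eq[OF assms(2) D(1)] pipe_dream_Dp[OF D(1)] Min
      by (auto simp: mitosis_def PD_def)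
    ultimately show ?thesis using D(2) ne by (simp add: D_def)
  qed
  \<comment> \<open>A nonempty \<open>J i E\<close> would make \<open>w \<circ> s i\<close> a value
    of \<open>sort_at _ i\<close>, hence fixed by sorting at \<open>i\<close>; but sorting sends it
    to \<open>w\<close>.\<close>
  have J_ws: "J i E = {}" if "E \<in> PD (w \<circ> s i)" for E
  proof (rule ccontr)
    assume "J i E \<noteq> {}"
    moreover have "pipe_dream E" "demazure E = w \<circ> s i" using that by (auto simp: PD_def)
    ultimately obtain u where "w \<circ> s i = sort_at u i"
      using demazure_Dp_Min[OF assms(2)] by metis
    then have "sort_at (w \<circ> s i) i = w \<circ> s i"
      using word_equiv_idem[of i] by (simp add: word_equiv_def)
    then show False using sort_ws ws_neq by simp
  qed
  have "(\<Union>D\<in>P_s w i. mitosis' i D) = PD (w \<circ> s i)"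
  proof
    show "(\<Union>D\<in>P_s w i. mitosis' i D) \<subseteq> PD (w \<circ> s i)"
      using up unfolding P_s_def by blast
    show "PD (w \<circ> s i) \<subseteq> (\<Union>D\<in>P_s w i. mitosis' i D)"
    proof
      fix E assume "E \<in> PD (w \<circ> s i)"
      from down[OF this J_ws[OF this] sort_ws]
      show "E \<in> (\<Union>D\<in>P_s w i. mitosis' i D)"
        by (intro UN_I[of "unmitosis i E"]) (simp_all add: P_s_def)
    qed
  qed
  moreover have "(\<Union>D\<in>P_I w i. mitosis' i D) = P_empty w i"
  proof
    show "(\<Union>D\<in>P_I w i. mitosis' i D) \<subseteq> P_empty w i"
    proof
      fix E assume "E \<in> (\<Union>D\<in>P_I w i. mitosis' i D)"
      then obtain D where D: "D \<in> P_I w i" "E \<in> mitosis' i D" by blast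
      then have "E \<in> PD w" using up[of D w E] by (simp add: P_I_def)
      moreover have "J i E = {}" using J_mitosis'[OF _ D(2)] D(1) fin(2) by blast
      ultimately show "E \<in> P_empty w i" by (simp add: P_empty_def)
    qed
    show "P_empty w i \<subseteq> (\<Union>D\<in>P_I w i. mitosis' i D)"
    proof
      fix E assume "E \<in> P_empty w i"
      then have "E \<in> PD w" "J i E = {}" by (simp_all add: P_empty_def)
      from down[OF this sort_w]
      show "E \<in> (\<Union>D\<in>P_I w i. mitosis' i D)"
        by (intro UN_I[of "unmitosis i E"]) (simp_all add: P_I_def)
    qed
  qed
  ultimately show ?thesis using disj fin by blast
qed

end
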